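(* Let $f(t)=\sum_{k=0}^{d}a_kt^k$, $d\ge5$, be a real univariate polynomial with positive coefficients satisfying $a_k^2>\sqrt{\alpha}\,a_{k-1}a_{k+1}$ for all $1\le k\le d-1$, where $\alpha$ is the unique positive root of the polynomial $t^3-t^2-2t-1$ ($\alpha\approx2.1479$). If $A$ is a real square matrix whose characteristic polynomial is $\chi_A(t)=f(t)$, then the linear time-invariant system $\frac{dx}{dt}=Ax$ is stable.
   Context: The system $\dot x=Ax$ (or the matrix $A$) is called stable if every eigenvalue of $A$ has negative real part. *)

theory Defs
  imports Complex_Main "Jordan_Normal_Form.Char_Poly"
begin

text \<open>Eigenvalues of a real matrix are taken over the complex numbers.\<close>

definition stable_mat :: "real mat \<Rightarrow> bool" where
  "stable_mat A \<longleftrightarrow> (\<forall>z. eigenvalue (map_mat complex_of_real A) z \<longrightarrow> Re z < 0)"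

definition \<alpha> :: real where
  "\<alpha> = (THE t. 0 < t \<and> t ^ 3 - t ^ 2 - 2 * t - 1 = 0)"

lemma ex1_\<alpha>: "\<exists>!t::real. 0 < t \<and> t ^ 3 - t ^ 2 - 2 * t - 1 = 0"
proof -
  obtain t :: real where "0 < t" "t ^ 3 - t ^ 2 - 2 * t - 1 = 0"
  proof -
    have "\<exists>t::real. 1 \<le> t \<and> t \<le> 3 \<and> t ^ 3 - t ^ 2 - 2 * t - 1 = 0"
      by (rule IVT') (auto intro!: continuous_intros)
    then show thesis using that by force
  qed
  moreover have "s = t"
    if s: "0 < s" "s ^ 3 - s ^ 2 - 2 * s - 1 = 0"
      and t: "0 < t" "t ^ 3 - t ^ 2 - 2 * t - 1 = 0" for s t :: real
  proof -
    have e: "1 / x + 2 / x ^ 2 + 1 / x ^ 3 = 1"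
      if "0 < x" "x ^ 3 - x ^ 2 - 2 * x - 1 = 0" for x :: real
    proof -
      have "1 / x + 2 / x ^ 2 + 1 / x ^ 3 = (x ^ 2 + 2 * x + 1) / x ^ 3"
        using that(1) by (simp add: power2_eq_square power3_eq_cube add_divide_distrib)
      also have "x ^ 2 + 2 * x + 1 = x ^ 3"
        using that(2) by linarith
      finally show ?thesis using that(1) by simp
    qed
    have less: "1 / y + 2 / y ^ 2 + 1 / y ^ 3 < 1 / x + 2 / x ^ 2 + 1 / x ^ 3"
      if "0 < x" "x < y" for x y :: real
      using that by (intro add_strict_mono divide_strict_left_mono power_strict_mono) auto
    show ?thesis
      using less[of s t] less[of t s] e[OF s] e[OF t] s(1) t(1) by linarith
  qed
  ultimately show ?thesis
    by blast
qed

lemma \<alpha>_pos: "0 < \<alpha>" and \<alpha>_root: "\<alpha> ^ 3 - \<alpha> ^ 2 - 2 * \<alpha> - 1 = 0"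
  using theI'[OF ex1_\<alpha>] unfolding \<alpha>_def by auto

end

theory Submission
  imports Defs "HOL-Complex_Analysis.Conformal_Mappings"
begin

text \<open>
  Multiplying the hypotheses for two consecutive indices gives
  \<open>\<alpha> a\<^sub>k a\<^sub>k\<^sub>+\<^sub>3 < a\<^sub>k\<^sub>+\<^sub>1 a\<^sub>k\<^sub>+\<^sub>2\<close>, which says that the ratios
  \<open>b\<^sub>k = a\<^sub>k\<^sub>+\<^sub>2 / a\<^sub>k\<close> decrease by more than the factor \<open>\<alpha>\<close> at each step.
  This condition, together with positive coefficients, forces all zeros into the open left half
  plane, as \<open>gap_log_concave_imp_hurwitz_stable\<close> shows; since the eigenvalues of a matrix are the zeros of
  its characteristic polynomial, the theorem follows.

  There is no zero on the imaginary axis. The condition is invariant under rescaling the variable,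
  so it suffices to consider the point \<open>\<i>\<close>, where a zero means that the alternating sums of the
  even-indexed and of the odd-indexed coefficients both vanish. Both subsequences are unimodal, and a
  vanishing alternating sum of a unimodal sequence forces its largest term to be at most the sum of
  the two neighbours. If \<open>m\<close> is the first index with \<open>b\<^sub>m < 1\<close>, then the largest terms of the
  two subsequences are \<open>a\<^sub>m\<close> and \<open>a\<^sub>m\<^sub>+\<^sub>1\<close>. With \<open>p = b\<^sub>m\<close> and \<open>q = 1 / b\<^sub>m\<^sub>-\<^sub>1\<close>, both at
  most 1, the outer neighbours are controlled by the decrease of the ratios, and the two peak
  inequalities become \<open>1 \<le> p + q / \<alpha>\<close> and \<open>1 \<le> q + p / \<alpha>\<close>. The smallest value of \<open>p q\<close> under
  these constraints is attained at \<open>p = q = \<alpha> / (\<alpha> + 1)\<close>, and it equals \<open>1 / \<alpha>\<close> precisely because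
  \<open>\<alpha>\<^sup>3 = (\<alpha> + 1)\<^sup>2\<close>. But \<open>p q = b\<^sub>m / b\<^sub>m\<^sub>-\<^sub>1 < 1 / \<alpha>\<close>, a contradiction
  (\<open>alternating_parity_sums_not_both_zero\<close>).

  From the axis to the half plane one goes by induction on the polynomial, adding a constant term
  \<open>a\<close> to \<open>z q(z)\<close>, where \<open>q\<close> is already known to be stable. The polynomials \<open>t + z q(z)\<close> with
  \<open>0 < t \<le> a\<close> all satisfy the condition, so no zero meets the imaginary axis while \<open>t\<close> grows from
  0; and the zero that starts at the origin moves to the left because \<open>q(0) > 0\<close>
  (\<open>constant_term_preserves_left_half_plane_zeros\<close>).
\<close>

section \<open>Alternating sums of unimodal sequences\<close>

lemma alternating_sum_decreasing_bounds:
  fixes c :: "nat \<Rightarrow> real"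
  assumes "\<And>j. 0 \<le> c j" and "\<And>j. c (Suc j) \<le> c j"
  shows "0 \<le> (\<Sum>j<n. (-1) ^ j * c j) \<and> (\<Sum>j<n. (-1) ^ j * c j) \<le> c 0"
  using assms
proof (induction n arbitrary: c)
  case (Suc n)
  have "(\<Sum>j<Suc n. (-1) ^ j * c j) = c 0 - (\<Sum>j<n. (-1) ^ j * c (Suc j))"
    by (simp add: sum.lessThan_Suc_shift sum_negf del: sum.lessThan_Suc)
  moreover have "0 \<le> (\<Sum>j<n. (-1) ^ j * c (Suc j)) \<and> (\<Sum>j<n. (-1) ^ j * c (Suc j)) \<le> c (Suc 0)"
    using Suc.prems by (intro Suc.IH)
  ultimately show ?case
    using Suc.prems(2)[of 0] by linarith
qed simp

lemma alternating_sum_increasing_bounds: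
  fixes c :: "nat \<Rightarrow> real"
  assumes "0 \<le> c 0" and "\<And>j. j < n \<Longrightarrow> c j \<le> c (Suc j)"
  shows "0 \<le> (-1) ^ n * (\<Sum>j\<le>n. (-1) ^ j * c j) \<and> (-1) ^ n * (\<Sum>j\<le>n. (-1) ^ j * c j) \<le> c n"
  using assms
proof (induction n)
  case (Suc n)
  have "(-1) ^ Suc n * (\<Sum>j\<le>Suc n. (-1) ^ j * c j) = c (Suc n) - (-1) ^ n * (\<Sum>j\<le>n. (-1) ^ j * c j)"
    by (simp add: algebra_simps flip: power_add mult_2)
  then show ?case
    using Suc.IH Suc.prems(1) Suc.prems(2)[of n] Suc.prems(2) by fastforce
qed simp

text \<open>
  Cut out the largest term: what remains on either side of it is a monotone alternating sum, which
  starts with the sign opposite to that of the largest term and is bounded by its first term, the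
  adjacent neighbour. Two such sums must cancel the peak.
\<close>

lemma alternating_sum_zero_imp_peak_le_neighbours:
  fixes c :: "nat \<Rightarrow> real"
  assumes nonneg: "\<And>j. 0 \<le> c j"
    and incr: "\<And>j. j < M \<Longrightarrow> c j \<le> c (Suc j)"
    and decr: "\<And>j. M \<le> j \<Longrightarrow> c (Suc j) \<le> c j"
    and "0 < M" "M < n"
    and zero: "(\<Sum>j<n. (-1) ^ j * c j) = 0"
  shows "c M \<le> c (M - 1) + c (Suc M)"
proof -
  obtain K where M: "M = Suc K"
    using \<open>0 < M\<close> by (cases M) auto
  define L where "L = (-1) ^ K * (\<Sum>j\<le>K. (-1) ^ j * c j)"
  define R where "R = (\<Sum>j<n - Suc M. (-1) ^ j * c (Suc M + j))"
  have n: "n = Suc (M + (n - Suc M))"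
    using \<open>M < n\<close> by simp
  have shift: "(\<Sum>j<M + k. g j) = (\<Sum>j<M. g j) + (\<Sum>j<k. g (M + j))" for g :: "nat \<Rightarrow> real" and k
    by (induction k) auto
  have "(-1) ^ M * (\<Sum>j<n. (-1) ^ j * c j)
      = (-1) ^ M * ((\<Sum>j<M. (-1) ^ j * c j) + (\<Sum>j<Suc (n - Suc M). (-1) ^ (M + j) * c (M + j)))"
    using shift[of "\<lambda>j. (-1) ^ j * c j" "Suc (n - Suc M)"] n by (metis add_Suc_right)
  also have "\<dots> = (-1) ^ M * (\<Sum>j<M. (-1) ^ j * c j) + (\<Sum>j<Suc (n - Suc M). (-1) ^ j * c (M + j))"
    by (simp add: distrib_left sum_distrib_left power_add mult.assoc[symmetric] del: sum.lessThan_Suc flip: power_mult_distrib)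
  also have "(-1) ^ M * (\<Sum>j<M. (-1) ^ j * c j) = - L"
    by (simp add: L_def M lessThan_Suc_atMost)
  also have "(\<Sum>j<Suc (n - Suc M). (-1) ^ j * c (M + j)) = c M - R"
    by (simp add: R_def sum.lessThan_Suc_shift sum_negf del: sum.lessThan_Suc)
  finally have "c M = L + R"
    using zero by simp
  moreover have "L \<le> c K"
    using alternating_sum_increasing_bounds[of c K] nonneg incr M unfolding L_def by auto
  moreover have "R \<le> c (Suc M)"
    using alternating_sum_decreasing_bounds[of "\<lambda>j. c (Suc M + j)" "n - Suc M"] nonneg decr
    unfolding R_def by auto
  ultimately show ?thesis
    using M by simp
qed

section \<open>The extremal inequality\<close>

lemma \<alpha>_cube: "\<alpha> ^ 3 = (\<alpha> + 1)\<^sup>2"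
  using \<alpha>_root by (simp add: power2_eq_square algebra_simps)

lemma \<alpha>_gt_1: "1 < \<alpha>"
proof (rule ccontr)
  assume "\<not> 1 < \<alpha>"
  then have "\<alpha> ^ 3 \<le> 1"
    using \<alpha>_pos by (intro power_le_one) auto
  moreover have "1 < (\<alpha> + 1)\<^sup>2"
    using \<alpha>_pos by (simp add: one_less_power)
  ultimately show False
    using \<alpha>_cube by simp
qed

text \<open>
  Put \<open>r = \<alpha> / (\<alpha> + 1)\<close>. The cubic equation for \<open>\<alpha>\<close> says that \<open>r\<close> and \<open>1 / r\<close> are the two
  roots of \<open>x\<^sup>2 - \<alpha> x + 1\<close>. The larger number \<open>q\<close> lies between them, whence
  \<open>\<alpha> q - q\<^sup>2 \<ge> 1\<close>; and \<open>\<alpha> p q\<close> is at least the left-hand side, as \<open>p \<ge> 1 - q / \<alpha>\<close>.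
\<close>

lemma peak_product_ordered:
  fixes p q :: real
  assumes "p \<le> q" "q \<le> 1" "1 \<le> p + q / \<alpha>"
  shows "1 \<le> \<alpha> * (p * q)"
proof -
  define r where "r = \<alpha> / (\<alpha> + 1)"
  have r: "0 < r" "r < 1"
    using \<alpha>_pos by (auto simp: r_def)
  have "\<alpha> \<le> q * (\<alpha> + 1)"
  proof -
    have "1 \<le> q + q / \<alpha>"
      using assms by linarith
    then show ?thesis
      using \<alpha>_pos by (simp add: field_simps)
  qed
  then have rq: "r \<le> q"
    using \<alpha>_pos by (simp add: r_def field_simps)
  have sum: "r + 1 / r = \<alpha>"
  proof -
    have "r + 1 / r = (\<alpha>\<^sup>2 + (\<alpha> + 1)\<^sup>2) / (\<alpha> * (\<alpha> + 1))"
      using \<alpha>_pos by (simp add: r_def field_simps power2_eq_square)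
    also have "\<alpha>\<^sup>2 + (\<alpha> + 1)\<^sup>2 = \<alpha> * (\<alpha> * (\<alpha> + 1))"
      using \<alpha>_cube by (simp add: algebra_simps power2_eq_square power3_eq_cube)
    finally show ?thesis
      using \<alpha>_pos by simp
  qed
  have "0 \<le> (q - r) * (1 / r - q)"
  proof (intro mult_nonneg_nonneg)
    have "1 \<le> 1 / r"
      using r by simp
    then show "0 \<le> 1 / r - q"
      using \<open>q \<le> 1\<close> by linarith
  qed (use rq in simp)
  also have "\<dots> = (r + 1 / r) * q - q\<^sup>2 - 1"
    using r by (simp add: field_simps power2_eq_square)
  finally have "1 \<le> \<alpha> * q - q\<^sup>2"
    unfolding sum by simp
  also have "\<dots> = \<alpha> * ((1 - q / \<alpha>) * q)"
    using \<alpha>_pos by (simp add: field_simps power2_eq_square)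
  also have "\<dots> \<le> \<alpha> * (p * q)"
    using assms rq r \<alpha>_pos by (intro mult_left_mono mult_right_mono) auto
  finally show ?thesis .
qed

lemma peak_product:
  fixes p q :: real
  assumes "p \<le> 1" "q \<le> 1" "1 \<le> p + q / \<alpha>" "1 \<le> q + p / \<alpha>"
  shows "1 \<le> \<alpha> * (p * q)"
  using peak_product_ordered[of p q] peak_product_ordered[of q p] assms
  by (cases "p \<le> q") (auto simp: mult.commute)

section \<open>No zeros on the imaginary axis\<close>

text \<open>
  This is the heart of the argument. The sequence vanishes at the indices 0 and 1 so that the
  neighbours \<open>m - 2\<close> and \<open>m - 1\<close> of the two peaks always exist, with value 0 if they lie below the
  actual coefficients. Products are compared in place of ratios because the outer terms may vanish.
\<close>

lemma alternating_parity_sums_not_both_zero: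
  fixes e :: "nat \<Rightarrow> real"
  assumes e0: "e 0 = 0" and e1: "e 1 = 0"
    and pos: "\<And>k. 2 \<le> k \<Longrightarrow> k \<le> D \<Longrightarrow> 0 < e k"
    and top: "\<And>k. D < k \<Longrightarrow> e k = 0"
    and gap: "\<And>k. 2 \<le> k \<Longrightarrow> k + 3 \<le> D \<Longrightarrow> \<alpha> * (e k * e (k + 3)) < e (k + 1) * e (k + 2)"
    and D: "3 \<le> D" "D < 2 * n"
    and even_sum: "(\<Sum>j<n. (-1) ^ j * e (2 * j)) = 0"
    and odd_sum: "(\<Sum>j<n. (-1) ^ j * e (2 * j + 1)) = 0"
  shows False
proof -
  have nonneg: "0 \<le> e k" for k
  proof -
    consider "k = 0" | "k = 1" | "2 \<le> k" "k \<le> D" | "D < k" by linarith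
    then show ?thesis
      using e0 e1 pos top by cases (auto intro: less_imp_le)
  qed
  have gap_le: "\<alpha> * (e k * e (k + 3)) \<le> e (k + 1) * e (k + 2)" for k
  proof -
    consider "k = 0" | "k = 1" | "D < k + 3" | "2 \<le> k" "k + 3 \<le> D" by linarith
    then show ?thesis
    proof cases
      case 4
      then show ?thesis using gap by (simp add: less_imp_le)
    qed (use e0 e1 top nonneg in auto)
  qed
  have ex: "e (D - 1 + 2) < e (D - 1)"
    using pos[of "D - 1"] top[of "D - 1 + 2"] D by auto
  \<comment> \<open>Up to \<open>m\<close> both parity classes increase, from \<open>m\<close> on both decrease: the peaks are at \<open>m\<close> and \<open>m + 1\<close>.\<close>
  define m where "m = (LEAST k. e (k + 2) < e k)"
  have m: "e (m + 2) < e m"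
    unfolding m_def using ex by (rule LeastI)
  have mD: "m \<le> D - 1"
    unfolding m_def using ex by (rule Least_le)
  have below: "e k \<le> e (k + 2)" if "k < m" for k
    using not_less_Least[of k "\<lambda>k. e (k + 2) < e k"] that unfolding m_def by auto
  have m2: "2 \<le> m"
  proof (rule ccontr)
    assume "\<not> 2 \<le> m"
    then have "m = 0 \<or> m = 1" by linarith
    then show False using m e0 e1 nonneg[of "m + 2"] by auto
  qed
  have above: "e (k + 2) \<le> e k" if "m \<le> k" for k
    using that
  proof (induction k rule: dec_induct)
    case base
    then show ?case using m by simp
  next
    case (step k)
    show ?case
    proof (cases "k \<le> D")
      case True
      then have ek: "0 < e k"
        using pos m2 step by simp
      have "e k * e (k + 3) \<le> \<alpha> * (e k * e (k + 3))"
        using mult_right_mono[of 1 \<alpha> "e k * e (k + 3)"] \<alpha>_gt_1 nonneg by simp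
      also have "\<dots> \<le> e (k + 1) * e (k + 2)"
        by (rule gap_le)
      also have "\<dots> \<le> e (k + 1) * e k"
        using step.IH nonneg by (intro mult_left_mono)
      finally show ?thesis
        using ek by (simp add: eval_nat_numeral mult.commute)
    next
      case False
      then show ?thesis using top nonneg by simp
    qed
  qed
  have peak: "e r \<le> e (r - 2) + e (r + 2)" if r: "r = m \<or> r = m + 1" for r
  proof -
    define s where "s = r mod 2"
    define M where "M = r div 2"
    have rM: "r = 2 * M + s"
      by (simp add: M_def s_def)
    have s: "s = 0 \<or> s = 1"
      by (auto simp: s_def)
    have Mr: "0 < M" "M < n"
      using r m2 mD D by (auto simp: M_def)
    have incr: "e (2 * j + s) \<le> e (2 * Suc j + s)" if "j < M" for j
    proof -
      have "2 * j + s < m" using that r rM by linarith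
      from below[OF this] show ?thesis by (simp add: algebra_simps)
    qed
    have decr: "e (2 * Suc j + s) \<le> e (2 * j + s)" if "M \<le> j" for j
    proof -
      have "m \<le> 2 * j + s" using that r rM by linarith
      from above[OF this] show ?thesis by (simp add: algebra_simps)
    qed
    have "(\<Sum>j<n. (-1) ^ j * e (2 * j + s)) = 0"
      using s even_sum odd_sum by auto
    then have "e (2 * M + s) \<le> e (2 * (M - 1) + s) + e (2 * Suc M + s)"
      using alternating_sum_zero_imp_peak_le_neighbours[of "\<lambda>j. e (2 * j + s)" M n]
        nonneg incr decr Mr by simp
    moreover have "2 * (M - 1) + s = r - 2" "2 * Suc M + s = r + 2"
      using rM Mr by auto
    ultimately show ?thesis
      using rM by simp
  qed
  \<comment> \<open>The inner neighbours of the peaks, \<open>e (m + 2)\<close> for \<open>e m\<close> and \<open>e (m - 1)\<close> for \<open>e (m + 1)\<close>, relative to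
    their peaks; the outer neighbours \<open>e (m - 2)\<close> and \<open>e (m + 3)\<close> are smaller by a factor of \<open>\<alpha>\<close>.\<close>
  define p q where "p = e (m + 2) / e m" and "q = e (m - 1) / e (m + 1)"
  have em: "0 < e m" and em1: "0 < e (m + 1)"
    using pos m2 mD D by auto
  have p: "p \<le> 1"
    using m em by (simp add: p_def)
  have q: "q \<le> 1"
  proof -
    have "e (m - 1) \<le> e (m + 1)"
      using below[of "m - 1"] m2 by (simp add: numeral_2_eq_2)
    then show ?thesis using em1 by (simp add: q_def)
  qed
  have pq1: "1 \<le> p + q / \<alpha>"
  proof -
    have "m - 2 + 3 = m + 1" "m - 2 + 1 = m - 1" "m - 2 + 2 = m" using m2 by auto
    then have "\<alpha> * (e (m - 2) * e (m + 1)) \<le> e (m - 1) * e m"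
      using gap_le[of "m - 2"] by metis
    then have "e (m - 2) \<le> q / \<alpha> * e m"
      using em1 \<alpha>_pos by (simp add: q_def field_simps)
    moreover have "e (m + 2) = p * e m"
      using em by (simp add: p_def)
    ultimately have "1 * e m \<le> (p + q / \<alpha>) * e m"
      using peak[of m] by (simp add: distrib_right)
    then show ?thesis
      using em by (rule mult_right_le_imp_le)
  qed
  have pq2: "1 \<le> q + p / \<alpha>"
  proof -
    have "\<alpha> * (e m * e (m + 3)) \<le> e (m + 1) * e (m + 2)"
      by (rule gap_le)
    then have "e (m + 3) \<le> p / \<alpha> * e (m + 1)"
      using em \<alpha>_pos by (simp add: p_def field_simps)
    moreover have "e (m - 1) = q * e (m + 1)"
      using em1 by (simp add: q_def)
    moreover have "e (m + 1) \<le> e (m - 1) + e (m + 3)"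
    proof -
      have "m + 1 - 2 = m - 1" "m + 1 + 2 = m + 3"
        by auto
      then show ?thesis
        using peak[of "m + 1"] by metis
    qed
    ultimately have "1 * e (m + 1) \<le> (q + p / \<alpha>) * e (m + 1)"
      by (simp only: distrib_right)
    then show ?thesis
      using em1 by (rule mult_right_le_imp_le)
  qed
  have lt: "\<alpha> * (e (m - 1) * e (m + 2)) < e m * e (m + 1)"
  proof (cases "3 \<le> m \<and> m + 2 \<le> D")
    case True
    then have "2 \<le> m - 1" "m - 1 + 3 \<le> D" by linarith+
    then have "\<alpha> * (e (m - 1) * e (m - 1 + 3)) < e (m - 1 + 1) * e (m - 1 + 2)"
      by (rule gap)
    moreover have "m - 1 + 3 = m + 2" "m - 1 + 1 = m" "m - 1 + 2 = m + 1"
      using m2 by auto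
    ultimately show ?thesis by metis
  next
    case False
    then have "m = 2 \<or> D < m + 2" using m2 by auto
    then have "e (m - 1) * e (m + 2) = 0"
      using e1 top by auto
    then have "\<alpha> * (e (m - 1) * e (m + 2)) = 0"
      by (simp only: mult_zero_right)
    moreover have "0 < e m * e (m + 1)"
      using em em1 by (rule mult_pos_pos)
    ultimately show ?thesis by linarith
  qed
  have "\<alpha> * (p * q) = \<alpha> * (e (m - 1) * e (m + 2)) / (e m * e (m + 1))"
    by (simp add: p_def q_def)
  also have "\<dots> < 1"
    using lt em em1 by simp
  finally show False
    using peak_product[OF p q pq1 pq2] by simp
qed

lemma poly_imaginary_axis_zero_imp_parity_sums_zero:
  fixes r :: "real poly" and y :: real
  assumes zero: "poly (map_poly complex_of_real r) (\<i> * of_real y) = 0"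
    and n: "degree r < 2 * n"
  shows "(\<Sum>j<n. (-1) ^ j * (coeff r (2 * j) * y ^ (2 * j))) = 0"
    and "(\<Sum>j<n. (-1) ^ j * (coeff r (2 * j + 1) * y ^ (2 * j + 1))) = 0"
proof -
  let ?E = "\<Sum>j<n. (-1) ^ j * (coeff r (2 * j) * y ^ (2 * j))"
  let ?O = "\<Sum>j<n. (-1) ^ j * (coeff r (2 * j + 1) * y ^ (2 * j + 1))"
  have split: "(\<Sum>k<2 * n. g k) = (\<Sum>j<n. g (2 * j)) + (\<Sum>j<n. g (2 * j + 1))" for g :: "nat \<Rightarrow> complex"
    by (induction n) (auto simp: algebra_simps)
  have "0 = (\<Sum>k\<le>degree r. of_real (coeff r k) * (\<i> * of_real y) ^ k)"
    using zero by (simp add: poly_altdef coeff_map_poly degree_map_poly)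
  also have "\<dots> = (\<Sum>k<2 * n. of_real (coeff r k) * (\<i> * of_real y) ^ k)"
    using n by (intro sum.mono_neutral_left) (auto simp: coeff_eq_0)
  also have "\<dots> = Complex ?E ?O"
  proof -
    have "(\<i> * complex_of_real y) ^ (2 * j) = of_real ((-1) ^ j * y ^ (2 * j))" for j
      using power_minus[of "(complex_of_real y)\<^sup>2" j] by (simp add: power_mult_distrib power_mult)
    then show ?thesis
      unfolding split by (simp add: complex_eq_iff mult_ac)
  qed
  finally show "?E = 0" "?O = 0"
    by (simp_all add: complex_eq_iff)
qed

text \<open>
  The second part says that the ratios \<open>coeff p (k + 2) / coeff p k\<close>, which compare neighbours within
  one parity class, decrease by more than the factor \<open>c\<close>. For \<open>c > 0\<close> the condition survives deleting
  the constant coefficient and making it smaller, which is what an induction on the degree requires.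
\<close>

definition gap_log_concave :: "real \<Rightarrow> real poly \<Rightarrow> bool" where
  "gap_log_concave c p \<longleftrightarrow>
     (\<forall>k\<le>degree p. 0 < coeff p k) \<and>
     (\<forall>k. k + 3 \<le> degree p \<longrightarrow> c * (coeff p k * coeff p (k + 3)) < coeff p (k + 1) * coeff p (k + 2))"

lemma no_zero_on_upper_imaginary_axis:
  assumes p: "gap_log_concave \<alpha> p" and deg: "0 < degree p" and y: "0 < y"
  shows "poly (map_poly complex_of_real p) (\<i> * of_real y) \<noteq> 0"
proof
  assume zero: "poly (map_poly complex_of_real p) (\<i> * of_real y) = 0"
  \<comment> \<open>Multiplying by the square of the variable supplies the two leading zeros of the sequence, and
    absorbing the powers of \<open>y\<close> moves the zero to \<open>\<i>\<close>.\<close>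
  define r where "r = pCons 0 (pCons 0 p)"
  define e where "e k = coeff r k * y ^ k" for k
  have "p \<noteq> 0"
    using deg by auto
  have degr: "degree r = degree p + 2"
    using \<open>p \<noteq> 0\<close> by (simp add: r_def)
  have e_shift: "e (k + 2) = coeff p k * y ^ (k + 2)" for k
    by (simp add: e_def r_def)
  have zr: "poly (map_poly complex_of_real r) (\<i> * of_real y) = 0"
    using zero by (simp add: r_def of_real_hom.map_poly_pCons_hom)
  show False
  proof (rule alternating_parity_sums_not_both_zero[of e "degree r" "degree r"])
    show "e 0 = 0" "e 1 = 0"
      by (simp_all add: e_def r_def)
    show "0 < e k" if "2 \<le> k" "k \<le> degree r" for k
    proof -
      define l where "l = k - 2"
      then have l: "k = l + 2"
        using that(1) by simp
      then have "l \<le> degree p"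
        using that degr by simp
      then have "0 < coeff p l"
        using p unfolding gap_log_concave_def by blast
      then show ?thesis
        unfolding l e_shift using y by (intro mult_pos_pos zero_less_power)
    qed
    show "e k = 0" if "degree r < k" for k
      using that by (simp add: e_def coeff_eq_0)
    show "\<alpha> * (e k * e (k + 3)) < e (k + 1) * e (k + 2)"
      if k: "2 \<le> k" "k + 3 \<le> degree r" for k
    proof -
      define l where "l = k - 2"
      then have l: "k = l + 2"
        using k(1) by simp
      have "\<alpha> * (coeff p l * coeff p (l + 3)) < coeff p (l + 1) * coeff p (l + 2)"
        using p k l degr by (simp add: gap_log_concave_def)
      then have "\<alpha> * (coeff p l * coeff p (l + 3)) * y ^ (2 * l + 7)
          < coeff p (l + 1) * coeff p (l + 2) * y ^ (2 * l + 7)"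
        using y by (intro mult_strict_right_mono) auto
      moreover have "e k * e (k + 3) = coeff p l * coeff p (l + 3) * y ^ (2 * l + 7)"
      proof -
        have "k + 3 = l + 3 + 2" "2 * l + 7 = (l + 2) + (l + 3 + 2)"
          using l by simp_all
        then show ?thesis
          by (simp only: l e_shift power_add[of y "l + 2"] mult_ac)
      qed
      moreover have "e (k + 1) * e (k + 2) = coeff p (l + 1) * coeff p (l + 2) * y ^ (2 * l + 7)"
      proof -
        have "k + 1 = l + 1 + 2" "k + 2 = l + 2 + 2" "2 * l + 7 = (l + 1 + 2) + (l + 2 + 2)"
          using l by simp_all
        then show ?thesis
          by (simp only: e_shift power_add[of y "l + 1 + 2"] mult_ac)
      qed
      ultimately show ?thesis
        by (simp add: mult.assoc)
    qed
    show "3 \<le> degree r" "degree r < 2 * degree r"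
      using deg degr by auto
  qed (use poly_imaginary_axis_zero_imp_parity_sums_zero[OF zr, of "degree r"] degr in
        \<open>simp_all add: e_def\<close>)
qed

lemma no_zero_on_imaginary_axis:
  assumes p: "gap_log_concave \<alpha> p" and "Re z = 0"
  shows "poly (map_poly complex_of_real p) z \<noteq> 0"
proof (cases "degree p = 0")
  case True
  then obtain b where "p = [:b:]"
    by (rule degree_eq_zeroE)
  then show ?thesis
    using p by (simp add: gap_log_concave_def of_real_hom.map_poly_pCons_hom)
next
  case False
  have z: "z = \<i> * of_real (Im z)"
    using \<open>Re z = 0\<close> by (simp add: complex_eq_iff)
  consider "Im z = 0" | "0 < Im z" | "Im z < 0" by linarith
  then show ?thesis
  proof cases
    case 1
    then have "z = 0" using z by simp
    then show ?thesis
      using p by (simp add: gap_log_concave_def poly_0_coeff_0 coeff_map_poly order_less_imp_not_eq2)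
  next
    case 2
    then show ?thesis
      using no_zero_on_upper_imaginary_axis[OF p, of "Im z"] False z by simp
  next
    case 3
    have cnj: "cnj z = \<i> * of_real (- Im z)"
      using \<open>Re z = 0\<close> by (simp add: complex_eq_iff)
    have "poly (map_poly complex_of_real p) (cnj z) \<noteq> 0"
      unfolding cnj using no_zero_on_upper_imaginary_axis[OF p, of "- Im z"] False 3 by simp
    moreover have "poly (map_poly complex_of_real p) (cnj z) = cnj (poly (map_poly complex_of_real p) z)"
      by (induction p) (simp_all add: of_real_hom.map_poly_pCons_hom)
    ultimately show ?thesis by auto
  qed
qed

section \<open>Growing the constant term\<close>

lemma poly_mult_not_constant_on_right_half_plane:
  fixes q :: "complex poly"
  assumes "q \<noteq> 0"
  shows "\<not> poly (pCons 0 q) constant_on {z. 0 < Re z}"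
proof
  assume "poly (pCons 0 q) constant_on {z. 0 < Re z}"
  then obtain c where c: "\<And>z. 0 < Re z \<Longrightarrow> poly (pCons 0 q) z = c"
    unfolding constant_on_def by blast
  obtain R where R: "\<And>z. R \<le> cmod z \<Longrightarrow> cmod c + 1 \<le> cmod (poly (pCons 0 q) z)"
    using poly_infinity[OF assms, of "cmod c + 1" 0] by blast
  define x where "x = complex_of_real (max R 1)"
  have "0 < Re x" "R \<le> cmod x"
    unfolding x_def by auto
  then show False
    using c[of x] R[of x] by simp
qed

text \<open>
  Write \<open>g(z) = z q(z)\<close>, so that the zeros of \<open>t + z q(z)\<close> are the solutions of \<open>g(z) = - t\<close>. If there
  are solutions in the closed right half plane with \<open>0 < t \<le> a\<close>, then one has the smallest \<open>t\<close>: they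
  stay bounded, and they stay away from the origin, near which \<open>q\<close> has positive real part and so
  \<open>z = - t / q(z)\<close> points to the left. The extremal solution is not on the imaginary axis, hence lies
  in the open half plane, where \<open>g\<close> is an open map; so a slightly smaller \<open>t\<close> is also attained.
\<close>

lemma constant_term_preserves_left_half_plane_zeros:
  fixes q :: "complex poly" and a :: real
  assumes q: "\<And>z. 0 \<le> Re z \<Longrightarrow> poly q z \<noteq> 0"
    and q0: "0 < Re (poly q 0)" "Im (poly q 0) = 0"
    and axis: "\<And>t z. 0 < t \<Longrightarrow> t \<le> a \<Longrightarrow> Re z = 0 \<Longrightarrow> poly (pCons (of_real t) q) z \<noteq> 0"
    and w: "0 \<le> Re w" and a: "0 < a"
  shows "poly (pCons (of_real a) q) w \<noteq> 0"
proof
  assume zero: "poly (pCons (of_real a) q) w = 0"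
  define g where "g = poly (pCons 0 q)"
  have g: "g z = z * poly q z" for z
    by (simp add: g_def)
  have q_nz: "q \<noteq> 0"
    using q[of 0] by auto
  obtain R where R: "\<And>z. R \<le> cmod z \<Longrightarrow> a + 1 \<le> cmod (g z)"
    using poly_infinity[OF q_nz, of "a + 1" 0] unfolding g_def by blast
  have "((\<lambda>z. Re (poly q z)) \<longlongrightarrow> Re (poly q 0)) (nhds 0)"
    by (intro tendsto_intros filterlim_ident)
  then have "\<forall>\<^sub>F z in nhds 0. 0 < Re (poly q z)"
    using q0 by (auto dest: order_tendstoD(1))
  \<comment> \<open>Inside the disc of this radius no solution of \<open>g z = - t\<close> with \<open>t > 0\<close> lies in the right half plane.\<close>
  then obtain \<delta> where \<delta>: "0 < \<delta>" "\<And>z. cmod z < \<delta> \<Longrightarrow> 0 < Re (poly q z)"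
    unfolding eventually_nhds_metric by (auto simp: dist_norm)
  have away: "\<delta> \<le> cmod z" if "0 \<le> Re z" "g z = - of_real t" "0 < t" for z t
  proof (rule ccontr)
    assume "\<not> \<delta> \<le> cmod z"
    then have "0 < Re (poly q z)"
      using \<delta> by simp
    \<comment> \<open>Multiply by the conjugate of \<open>q(z)\<close> and compare real parts.\<close>
    have "z * poly q z = - of_real t" using that g by simp
    then have "z * (poly q z * cnj (poly q z)) = - (of_real t * cnj (poly q z))"
      by (metis mult.assoc mult_minus_left)
    then have "z * of_real ((cmod (poly q z))\<^sup>2) = - (of_real t * cnj (poly q z))"
      by (simp only: complex_norm_square[symmetric] of_real_power)
    then have "Re (z * of_real ((cmod (poly q z))\<^sup>2)) = Re (- (of_real t * cnj (poly q z)))"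
      by (rule arg_cong)
    then have "Re z * (cmod (poly q z))\<^sup>2 = - (t * Re (poly q z))"
      by simp
    moreover have "0 < t * Re (poly q z)"
      using \<open>0 < Re (poly q z)\<close> \<open>0 < t\<close> by simp
    moreover have "0 \<le> Re z * (cmod (poly q z))\<^sup>2"
      using that by simp
    ultimately show False by linarith
  qed
  define K where "K = {z. 0 \<le> Re z \<and> Im (g z) = 0 \<and> - a \<le> Re (g z) \<and> Re (g z) \<le> 0 \<and> \<delta> \<le> cmod z \<and> cmod z \<le> R}"
  have K_I: "z \<in> K" if "0 \<le> Re z" "g z = - of_real t" "0 < t" "t \<le> a" for z t
  proof -
    have "cmod z \<le> R"
      using R[of z] that by (cases "R \<le> cmod z") auto
    then show ?thesis
      using that away[OF that(1-3)] by (simp add: K_def)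
  qed
  have cont: "continuous_on A g" for A
    unfolding g_def by (intro continuous_intros)
  have "compact K"
  proof -
    have "closed K"
      unfolding K_def
      by (intro closed_Collect_conj closed_Collect_le closed_Collect_eq continuous_intros cont)
    moreover have "bounded K"
      unfolding bounded_iff K_def by blast
    ultimately show ?thesis by (simp add: compact_eq_bounded_closed)
  qed
  moreover have "w \<in> K"
    using zero w a g by (intro K_I[of w a]) (auto simp: add_eq_0_iff)
  moreover have "continuous_on K (\<lambda>z. Re (g z))"
    by (intro continuous_intros cont)
  ultimately obtain z where z: "z \<in> K" and z_max: "\<And>y. y \<in> K \<Longrightarrow> Re (g y) \<le> Re (g z)"
    using continuous_attains_sup[of K "\<lambda>z. Re (g z)"] by blast
  \<comment> \<open>Maximising the real part of \<open>g\<close>, which is \<open>- t\<close>, picks the smallest \<open>t\<close>.\<close>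
  define t where "t = - Re (g z)"
  have gz: "g z = - of_real t"
    using z by (simp add: K_def t_def complex_eq_iff)
  have "g z \<noteq> 0"
    using z \<delta> q[of z] by (auto simp: K_def g)
  then have "t \<noteq> 0"
    using gz by auto
  moreover have "0 \<le> t" "t \<le> a"
    using z unfolding K_def t_def by auto
  ultimately have t: "0 < t" "t \<le> a"
    by auto
  have "Re z \<noteq> 0"
    using axis[OF t, of z] gz g by auto
  then have "0 < Re z"
    using z by (simp add: K_def)
  have "open (g ` {z. 0 < Re z})"
    unfolding g_def
  proof (rule open_mapping_thm)
    show "connected {z. 0 < Re z}"
      by (intro convex_connected convex_halfspace_Re_gt)
    show "\<not> poly (pCons 0 q) constant_on {z. 0 < Re z}"
      using q_nz by (rule poly_mult_not_constant_on_right_half_plane)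
  qed (auto intro!: holomorphic_intros open_halfspace_Re_gt)
  moreover have "g z \<in> g ` {z. 0 < Re z}"
    using \<open>0 < Re z\<close> by simp
  ultimately obtain \<epsilon> where \<epsilon>: "0 < \<epsilon>" "cball (g z) \<epsilon> \<subseteq> g ` {z. 0 < Re z}"
    unfolding open_contains_cball by blast
  define s where "s = min \<epsilon> (t / 2)"
  have s: "0 < s" "s \<le> \<epsilon>" "s < t"
    using \<epsilon> t by (auto simp: s_def)
  have "g z + of_real s \<in> cball (g z) \<epsilon>"
    using s by (simp add: dist_norm)
  then have "g z + of_real s \<in> g ` {z. 0 < Re z}"
    using \<epsilon>(2) by (rule subsetD[rotated])
  then obtain y where y: "0 < Re y" "g y = g z + of_real s"
    by (metis (lifting) imageE mem_Collect_eq)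
  have "g y = - of_real (t - s)"
    using y gz by simp
  then have "y \<in> K"
    using y(1) s t by (intro K_I[of y "t - s"]) linarith+
  then show False
    using z_max[of y] y s by simp
qed

section \<open>Stability\<close>

lemma gap_log_concave_pCons_tail:
  assumes "gap_log_concave c (pCons a p)" "p \<noteq> 0"
  shows "gap_log_concave c p"
  using assms(1) unfolding gap_log_concave_def
proof (elim conjE, intro conjI allI impI)
  assume pos: "\<forall>k\<le>degree (pCons a p). 0 < coeff (pCons a p) k"
    and gap: "\<forall>k. k + 3 \<le> degree (pCons a p) \<longrightarrow> c * (coeff (pCons a p) k * coeff (pCons a p) (k + 3))
        < coeff (pCons a p) (k + 1) * coeff (pCons a p) (k + 2)"
  show "0 < coeff p k" if "k \<le> degree p" for k
    using pos[rule_format, of "Suc k"] that assms(2) by simp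
  show "c * (coeff p k * coeff p (k + 3)) < coeff p (k + 1) * coeff p (k + 2)" if "k + 3 \<le> degree p" for k
    using gap[rule_format, of "Suc k"] that assms(2) by (simp add: eval_nat_numeral)
qed

lemma gap_log_concave_pCons_smaller:
  assumes p: "gap_log_concave c (pCons a p)" and "0 < c" "0 < t" "t \<le> a"
  shows "gap_log_concave c (pCons t p)"
  unfolding gap_log_concave_def
proof (intro conjI allI impI)
  have deg: "degree (pCons t p) = degree (pCons a p)"
    by simp
  fix k
  show "0 < coeff (pCons t p) k" if "k \<le> degree (pCons t p)"
    using p that \<open>0 < t\<close> unfolding gap_log_concave_def deg
    by (cases k) auto
  assume k: "k + 3 \<le> degree (pCons t p)"
  have "c * (coeff (pCons t p) k * coeff p (k + 2)) \<le> c * (coeff (pCons a p) k * coeff p (k + 2))"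
  proof (intro mult_left_mono mult_right_mono)
    show "coeff (pCons t p) k \<le> coeff (pCons a p) k"
      using \<open>t \<le> a\<close> by (cases k) auto
    have "0 < coeff (pCons a p) (k + 3)"
      using p k unfolding gap_log_concave_def deg by blast
    then show "0 \<le> coeff p (k + 2)"
      by (simp add: eval_nat_numeral)
  qed (use \<open>0 < c\<close> in simp)
  moreover have "c * (coeff (pCons a p) k * coeff (pCons a p) (k + 3))
      < coeff (pCons a p) (k + 1) * coeff (pCons a p) (k + 2)"
    using p k unfolding gap_log_concave_def deg by blast
  ultimately show "c * (coeff (pCons t p) k * coeff (pCons t p) (k + 3))
      < coeff (pCons t p) (k + 1) * coeff (pCons t p) (k + 2)"
    by (simp add: eval_nat_numeral)
qed

text \<open>
  Prepending a coefficient preserves stability: every polynomial on the way from constant term 0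
  to \<open>a\<close> satisfies the same condition, so none of them has a zero on the imaginary axis.
\<close>

theorem gap_log_concave_imp_hurwitz_stable:
  assumes "gap_log_concave \<alpha> p" and "poly (map_poly complex_of_real p) z = 0"
  shows "Re z < 0"
  using assms
proof (induction p arbitrary: z)
  case 0
  then show ?case by (auto simp: gap_log_concave_def)
next
  case (pCons a p)
  have a: "0 < a"
    using pCons.prems(1) by (auto simp: gap_log_concave_def dest!: spec[of _ 0])
  show ?case
  proof (cases "p = 0")
    case True
    then show ?thesis using pCons.prems(2) a by (simp add: of_real_hom.map_poly_pCons_hom)
  next
    case False
    have p: "gap_log_concave \<alpha> p"
      using gap_log_concave_pCons_tail[OF pCons.prems(1) False] .
    show ?thesis
    proof (rule ccontr)
      assume "\<not> Re z < 0"
      have "poly (pCons (of_real a) (map_poly complex_of_real p)) z \<noteq> 0"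
      proof (rule constant_term_preserves_left_half_plane_zeros)
        show "poly (map_poly complex_of_real p) u \<noteq> 0" if "0 \<le> Re u" for u
          using pCons.IH[OF p] that by force
        show "0 < Re (poly (map_poly complex_of_real p) 0)" "Im (poly (map_poly complex_of_real p) 0) = 0"
          using p by (simp_all add: poly_0_coeff_0 coeff_map_poly gap_log_concave_def)
        show "poly (pCons (of_real t) (map_poly complex_of_real p)) u \<noteq> 0"
          if "0 < t" "t \<le> a" "Re u = 0" for t u
          using no_zero_on_imaginary_axis[OF gap_log_concave_pCons_smaller[OF pCons.prems(1) \<alpha>_pos that(1,2)] that(3)]
            False by (simp add: of_real_hom.map_poly_pCons_hom)
      qed (use a \<open>\<not> Re z < 0\<close> in auto)
      then show False
        using pCons.prems(2) by (simp add: of_real_hom.map_poly_pCons_hom)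
    qed
  qed
qed

theorem theorem5p4:
  fixes a :: "nat \<Rightarrow> real" and d n :: nat and f :: "real poly" and A :: "real mat"
  assumes "d \<ge> 5"
    and "f = (\<Sum>k = 0..d. monom (a k) k)"
    and "\<forall>k \<le> d. 0 < a k"
    and "\<forall>k. 1 \<le> k \<and> k \<le> d - 1 \<longrightarrow> (a k)\<^sup>2 > sqrt \<alpha> * a (k - 1) * a (k + 1)"
    and "A \<in> carrier_mat n n"
    and "char_poly A = f"
  shows "stable_mat A"
proof -
  have coeff_f: "coeff f k = (if k \<le> d then a k else 0)" for k
    unfolding assms(2) by (simp add: coeff_sum)
  have "degree f = d"
  proof (rule antisym)
    show "degree f \<le> d"
      by (rule degree_le) (simp add: coeff_f)
    show "d \<le> degree f"
      using assms(3) by (intro le_degree) (simp add: coeff_f order_less_imp_not_eq2)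
  qed
  have "gap_log_concave \<alpha> f"
    unfolding gap_log_concave_def \<open>degree f = d\<close>
  proof (intro conjI allI impI)
    show "0 < coeff f k" if "k \<le> d" for k
      using that assms(3) by (simp add: coeff_f)
    fix k assume k: "k + 3 \<le> d"
    have pos: "0 < a k" "0 < a (k + 1)" "0 < a (k + 2)" "0 < a (k + 3)"
      using assms(3) k by auto
    have "sqrt \<alpha> * a k * a (k + 2) < (a (k + 1))\<^sup>2"
      using assms(4)[rule_format, of "k + 1"] k by (simp add: eval_nat_numeral)
    moreover have "sqrt \<alpha> * a (k + 1) * a (k + 3) < (a (k + 2))\<^sup>2"
      using assms(4)[rule_format, of "k + 2"] k by (simp add: eval_nat_numeral)
    ultimately have "(sqrt \<alpha> * a k * a (k + 2)) * (sqrt \<alpha> * a (k + 1) * a (k + 3))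
        < (a (k + 1))\<^sup>2 * (a (k + 2))\<^sup>2"
      using pos \<alpha>_pos by (intro mult_strict_mono') auto
    also have "(sqrt \<alpha> * a k * a (k + 2)) * (sqrt \<alpha> * a (k + 1) * a (k + 3))
        = (sqrt \<alpha>)\<^sup>2 * (a k * a (k + 3)) * (a (k + 1) * a (k + 2))"
      by (simp only: power2_eq_square ac_simps)
    also have "(a (k + 1))\<^sup>2 * (a (k + 2))\<^sup>2 = (a (k + 1) * a (k + 2)) * (a (k + 1) * a (k + 2))"
      by (simp only: power2_eq_square ac_simps)
    finally show "\<alpha> * (coeff f k * coeff f (k + 3)) < coeff f (k + 1) * coeff f (k + 2)"
      using pos \<alpha>_pos k by (simp add: coeff_f)
  qed
  moreover have "char_poly (map_mat complex_of_real A) = map_poly complex_of_real f"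
    using of_real_hom.char_poly_hom[OF assms(5)] assms(6) by simp
  moreover have "map_mat complex_of_real A \<in> carrier_mat n n"
    using assms(5) by simp
  ultimately show ?thesis
    unfolding stable_mat_def
    using gap_log_concave_imp_hurwitz_stable eigenvalue_root_char_poly by metis
qed

end
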